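(* Let $N$ be a non-negative integer and $p\in\mathbb{C}$ with $p\ne0,1$. For every integer $n>N$ the Krawtchouk polynomials satisfy $$K_n(x;p,N)=K_{N+1}(x;p,N)\,M_{n-N-1}\!\left(x-N-1;\ N+2,\ \frac{p}{p-1}\right).$$
   Context: $(a)_0=1$, $(a)_n=a(a+1)\cdots(a+n-1)$. Monic Krawtchouk polynomials of every degree $n\ge0$ are $K_n(x;p,N)=(-N)_np^n\,{}_2F_1\!\left(\begin{array}{c}-n,\ -x\\-N\end{array}\Big|\frac1p\right)$, read after cancelling as $$K_n(x;p,N)=\sum_{k=0}^n\frac{(-n)_k(-x)_k}{k!}(-N+k)_{n-k}\,p^{n-k}.$$ Monic Meixner polynomials are $M_n(x;\beta,c)=\frac{c^n(\beta)_n}{(c-1)^n}\,{}_2F_1\!\left(\begin{array}{c}-n,\ -x\\ \beta\end{array}\Big|1-\frac1c\right)$. *)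

theory Defs
  imports "HOL-Analysis.Analysis"
begin

definition hyp2F1 :: "complex \<Rightarrow> complex \<Rightarrow> complex \<Rightarrow> complex \<Rightarrow> complex" where
  "hyp2F1 a b c z = eval_fps (fps_hypergeo [a, b] [c] 1) z"

text \<open>
  With an upper parameter \<open>-n\<close> the series terminates, so its value is meaningful for every
  \<open>z\<close>, not only inside the unit disc.
\<close>

lemma hyp2F1_terminating:
  "hyp2F1 (- of_nat n) b c z =
     (\<Sum>k\<le>n. pochhammer (- of_nat n) k * pochhammer b k / (pochhammer c k * fact k) * z ^ k)"
proof -
  have "pochhammer (- of_nat n :: complex) k = 0" if "k \<notin> {..n}" for k
    using that by (simp add: pochhammer_of_nat_eq_0_iff)
  then show ?thesis
    unfolding hyp2F1_def eval_fps_def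
    by (subst suminf_finite[where N = "{..n}"]) (auto simp: of_nat_fact)
qed

text \<open>
  The cancelled form is the definition: it stays meaningful when \<open>N\<close> is a
  non-negative integer and \<open>n > N\<close>, where the hypergeometric series has a zero denominator.
\<close>

definition krawtchouk :: "nat \<Rightarrow> complex \<Rightarrow> complex \<Rightarrow> complex \<Rightarrow> complex" where
  "krawtchouk n x p N =
     (\<Sum>k=0..n. pochhammer (- of_nat n) k * pochhammer (- x) k / fact k
        * pochhammer (- N + of_nat k) (n - k) * p ^ (n - k))"

lemma krawtchouk_hyp2F1:
  assumes "pochhammer (- N) n \<noteq> 0" and "p \<noteq> 0"
  shows "krawtchouk n x p N =
    pochhammer (- N) n * p ^ n * hyp2F1 (- of_nat n) (- x) (- N) (1 / p)"
proof -
  have *: "pochhammer (- of_nat n) k * pochhammer (- x) k / fact k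
        * pochhammer (- N + of_nat k) (n - k) * p ^ (n - k) =
      pochhammer (- N) n * p ^ n * (pochhammer (- of_nat n) k * pochhammer (- x) k
        / (pochhammer (- N) k * fact k) * (1 / p) ^ k)" if "k \<le> n" for k
  proof -
    have 1: "pochhammer (- N) n = pochhammer (- N) k * pochhammer (- N + of_nat k) (n - k)"
      using that by (rule pochhammer_product)
    have 2: "p ^ n = p ^ k * p ^ (n - k)"
      using that by (simp flip: power_add)
    have "pochhammer (- N) k \<noteq> 0"
      using 1 assms by auto
    then show ?thesis
      unfolding 1 2 using assms(2) by (simp add: field_simps)
  qed
  show ?thesis
    unfolding krawtchouk_def hyp2F1_terminating sum_distrib_left
    by (intro sum.cong *) auto
qed

definition meixner :: "nat \<Rightarrow> complex \<Rightarrow> complex \<Rightarrow> complex \<Rightarrow> complex" where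
  "meixner n x \<beta> c =
     c ^ n * pochhammer \<beta> n / (c - 1) ^ n * hyp2F1 (- of_nat n) (- x) \<beta> (1 - 1 / c)"

end

theory Submission
  imports Defs
begin

text \<open>
  For \<open>n > N\<close> the factor \<open>(-N+k)\<^sub>n\<^sub>-\<^sub>k\<close> vanishes unless \<open>k > N\<close>, so \<open>(-x)\<^sub>N\<^sub>+\<^sub>1\<close> splits off from every
  remaining term. The cofactor is again a Krawtchouk sum, with parameter \<open>-N-2\<close>, and Krawtchouk
  polynomials with parameter \<open>-\<beta>\<close> are the Meixner polynomials with parameters \<open>\<beta>\<close>, \<open>p/(p-1)\<close>.
\<close>

lemma pochhammer_of_nat_plus_1:
  "pochhammer (of_nat a + 1 :: 'a :: field_char_0) k = fact (a + k) / fact a"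
  by (induction k) (simp_all add: pochhammer_Suc algebra_simps)

lemma pochhammer_minus_of_nat_div_fact:
  "pochhammer (- of_nat n :: 'a :: field_char_0) k / fact k = (-1) ^ k * of_nat (n choose k)"
  by (simp add: binomial_gbinomial gbinomial_pochhammer flip: power_mult_distrib mult.assoc)

text \<open>With \<open>c = p / (p - 1)\<close> one has \<open>c / (c - 1) = p\<close> and
  \<open>1 - 1 / c = 1 / p\<close>, so prefactor and argument both become those of the Krawtchouk
  series. Since \<open>pochhammer \<beta> n\<close> is nonzero, that series agrees with the
  cancelled form.\<close>

lemma meixner_eq_krawtchouk:
  assumes "p \<noteq> 0" and "p \<noteq> 1" and "pochhammer \<beta> n \<noteq> 0"
  shows "meixner n y \<beta> (p / (p - 1)) = krawtchouk n y p (- \<beta>)"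
proof -
  have c: "p / (p - 1) - 1 = 1 / (p - 1)" "1 - 1 / (p / (p - 1)) = 1 / p"
    using assms by (simp_all add: field_simps)
  have "(p / (p - 1)) ^ n * pochhammer \<beta> n / (1 / (p - 1)) ^ n = pochhammer \<beta> n * p ^ n"
    using assms by (simp add: power_divide)
  then show ?thesis
    unfolding meixner_def c using assms by (simp add: krawtchouk_hyp2F1)
qed

text \<open>The surviving indices are \<open>k = N + 1 + j\<close>. There
  \<open>pochhammer (- of_nat n) k / fact k\<close>, with \<open>n = N + 1 + m\<close>, is a signed
  binomial coefficient, and the cancelled denominator is
  \<open>pochhammer (of_nat j + 1) (m - j)\<close>, a quotient of factorials.\<close>

lemma krawtchouk_drop_terms:
  "krawtchouk (N + 1 + m) x p (of_nat N) =
     pochhammer (- x) (N + 1) *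
     (\<Sum>j=0..m. (-1) ^ (N + 1 + j) * of_nat ((N + 1 + m) choose (N + 1 + j))
        * pochhammer (of_nat N + 1 - x) j * (fact m / fact j) * p ^ (m - j))"
proof -
  define f where "f k = pochhammer (- of_nat (N + 1 + m)) k * pochhammer (- x) k / fact k
      * pochhammer (- of_nat N + of_nat k) (N + 1 + m - k) * p ^ (N + 1 + m - k)" for k
  \<comment> \<open>The third Pochhammer symbol starts at \<open>-(N - k)\<close> and has more than
    \<open>N - k\<close> factors, so one of them is 0.\<close>
  have zero: "f k = 0" if "k \<le> N" for k
  proof -
    have "- of_nat N + of_nat k = (- of_nat (N - k) :: complex)"
      using that by (simp add: of_nat_diff)
    moreover have "pochhammer (- of_nat (N - k) :: complex) (N + 1 + m - k) = 0"
      using that by (simp add: pochhammer_of_nat_eq_0_iff del: of_nat_diff)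
    ultimately show ?thesis
      unfolding f_def by simp
  qed
  have shift: "f (j + (N + 1)) = pochhammer (- x) (N + 1) *
      ((-1) ^ (N + 1 + j) * of_nat ((N + 1 + m) choose (N + 1 + j))
        * pochhammer (of_nat N + 1 - x) j * (fact m / fact j) * p ^ (m - j))"
    if "j \<le> m" for j
  proof -
    have 1: "pochhammer (- x) (N + 1 + j) =
        pochhammer (- x) (N + 1) * pochhammer (of_nat N + 1 - x) j"
      using pochhammer_product[of "N + 1" "N + 1 + j" "- x"] by (simp add: algebra_simps)
    have 2: "- of_nat N + of_nat (j + (N + 1)) = (of_nat j + 1 :: complex)"
      by simp
    have 3: "N + 1 + m - (j + (N + 1)) = m - j"
      by simp
    have 4: "pochhammer (of_nat j + 1 :: complex) (m - j) = fact m / fact j"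
      using that by (simp add: pochhammer_of_nat_plus_1)
    have "f (j + (N + 1)) = (pochhammer (- of_nat (N + 1 + m)) (N + 1 + j) / fact (N + 1 + j))
        * pochhammer (- x) (N + 1 + j) * (fact m / fact j) * p ^ (m - j)"
      unfolding f_def 2 3 4 by (simp add: add.commute)
    then show ?thesis
      unfolding 1 pochhammer_minus_of_nat_div_fact by (simp only: mult_ac)
  qed
  have "krawtchouk (N + 1 + m) x p (of_nat N) = sum f {0..N + 1 + m}"
    unfolding krawtchouk_def f_def ..
  also have "\<dots> = sum f {N + 1..N + 1 + m}"
    by (rule sum.mono_neutral_right) (auto intro: zero)
  also have "\<dots> = (\<Sum>j=0..m. f (j + (N + 1)))"
    using sum.shift_bounds_cl_nat_ivl[of f 0 "N + 1" m] by (simp add: add.commute)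
  also have "\<dots> = (\<Sum>j=0..m. pochhammer (- x) (N + 1) *
      ((-1) ^ (N + 1 + j) * of_nat ((N + 1 + m) choose (N + 1 + j))
        * pochhammer (of_nat N + 1 - x) j * (fact m / fact j) * p ^ (m - j)))"
    by (intro sum.cong refl shift) simp
  finally show ?thesis
    by (simp only: sum_distrib_left)
qed

text \<open>Once \<open>pochhammer (- x) (N + 1)\<close> and the sign \<open>(-1) ^ (N + 1)\<close>
  are split off, the two sums over \<open>j\<close> agree term by term.\<close>

lemma krawtchouk_factor:
  "krawtchouk (N + 1 + m) x p (of_nat N) =
     krawtchouk (N + 1) x p (of_nat N) * krawtchouk m (x - of_nat N - 1) p (- (of_nat N + 2))"
proof -
  \<comment> \<open>For \<open>m = 0\<close> only \<open>j = 0\<close> remains, with coefficient 1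
    up to sign.\<close>
  have K: "krawtchouk (N + 1) x p (of_nat N) = (-1) ^ (N + 1) * pochhammer (- x) (N + 1)"
    using krawtchouk_drop_terms[of N 0 x p] by simp
  have term_eq: "pochhammer (- of_nat m) j * pochhammer (- (x - of_nat N - 1)) j / fact j
        * pochhammer (- (- (of_nat N + 2)) + of_nat j) (m - j) * p ^ (m - j)
      = (-1) ^ j * of_nat ((N + 1 + m) choose (N + 1 + j))
        * pochhammer (of_nat N + 1 - x) j * (fact m / fact j) * p ^ (m - j)"
    if "j \<le> m" for j
  proof -
    have 1: "pochhammer (- (- (of_nat N + 2)) + of_nat j :: complex) (m - j)
        = fact (N + 1 + m) / fact (N + 1 + j)"
      using pochhammer_of_nat_plus_1[of "N + 1 + j" "m - j", where 'a = complex] that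
      by (simp add: add_ac)
    have 2: "- (x - of_nat N - 1) = of_nat N + 1 - x"
      by simp
    \<comment> \<open>Both sides are \<open>m! (N+1+m)! / (j! (m-j)! (N+1+j)!)\<close>, because the
      shift by \<open>N + 1\<close> preserves the difference \<open>m - j\<close>.\<close>
    have 3: "of_nat (m choose j) * (fact (N + 1 + m) / fact (N + 1 + j))
        = (of_nat ((N + 1 + m) choose (N + 1 + j)) * (fact m / fact j) :: complex)"
      using that by (simp add: binomial_fact mult_ac del: fact_Suc binomial_Suc_Suc)
    have "pochhammer (- of_nat m) j * pochhammer (of_nat N + 1 - x) j / fact j
        * (fact (N + 1 + m) / fact (N + 1 + j)) * p ^ (m - j)
      = pochhammer (- of_nat m) j / fact j * pochhammer (of_nat N + 1 - x) j
        * (fact (N + 1 + m) / fact (N + 1 + j)) * p ^ (m - j)"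
      by simp
    also have "\<dots> = (-1) ^ j * pochhammer (of_nat N + 1 - x) j
        * (of_nat (m choose j) * (fact (N + 1 + m) / fact (N + 1 + j))) * p ^ (m - j)"
      unfolding pochhammer_minus_of_nat_div_fact by (simp only: mult_ac)
    finally show ?thesis
      unfolding 1 2 3 by (simp only: mult_ac)
  qed
  have "krawtchouk m (x - of_nat N - 1) p (- (of_nat N + 2)) =
      (\<Sum>j=0..m. (-1) ^ j * of_nat ((N + 1 + m) choose (N + 1 + j))
        * pochhammer (of_nat N + 1 - x) j * (fact m / fact j) * p ^ (m - j))"
    unfolding krawtchouk_def by (intro sum.cong refl term_eq) simp
  then show ?thesis
    unfolding krawtchouk_drop_terms[of N m] K
    by (simp only: sum_distrib_left power_add mult_ac)
qed

theorem mainTheorem8: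
  fixes N n :: nat and p x :: complex
  assumes "p \<noteq> 0" and "p \<noteq> 1" and "n > N"
  shows "krawtchouk n x p (of_nat N) =
    krawtchouk (N + 1) x p (of_nat N)
      * meixner (n - N - 1) (x - of_nat N - 1) (of_nat N + 2) (p / (p - 1))"
proof -
  \<comment> \<open>Writing \<open>N + 2\<close> as \<open>(N + 1) + 1\<close> exhibits the symbol
    as a quotient of factorials, hence nonzero, as the passage to Meixner polynomials
    requires.\<close>
  have "pochhammer (of_nat (N + 1) + 1 :: complex) (n - N - 1) \<noteq> 0"
    by (simp only: pochhammer_of_nat_plus_1 divide_eq_0_iff fact_nonzero) simp
  then have "pochhammer (of_nat N + 2 :: complex) (n - N - 1) \<noteq> 0"
    by (simp add: add_ac)
  moreover have "N + 1 + (n - N - 1) = n"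
    using assms by simp
  ultimately show ?thesis
    using krawtchouk_factor[of N "n - N - 1" x p] assms by (simp add: meixner_eq_krawtchouk del: minus_add_distrib)
qed

end
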